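(* Let $F$ be a free group with a fixed well-ordered, symmetric, free generating set. For any finite sequence $g_1,\ldots,g_n\in F$, if $\sum_i g_i$ is not the zero chain in $\overline{C}_1(F)$, then there is an effective word $w\in F$ with $\sum_i\phi_w(g_i)\ge 1$.
   Context: $F$ is a free group, possibly of infinite rank. $C_1(F)$ is the real vector space freely generated by the elements of $F$, and $\overline{C}_1(F)$ is the quotient of $C_1(F)$ by the subspace spanned by all elements of the form $g^n-ng$ and $g-hgh^{-1}$, with $g,h\in F$, $n\in\mathbf{Z}$; here $g^n$ is the basis element given by the group element $g^n$ and $ng$ is $n$ times the basis element $g$. Fix a well-ordered, symmetric, free generating set of $F$ (i.e. $X\cup X^{-1}$ for a free basis $X$, equipped with a well-ordering) and equip $F$ (viewed as reduced words) with the lexicographical order. For a cyclically reduced word $w$, $[w]$ is the finite set of conjugates of $w$ obtained by cyclically permuting its letters. A nontrivial word $w$ is indivisible if it is not a proper power of another word. A word $w\in F$ is effective if it is indivisible and cyclically reduced, and it has minimal lexicographical order among all elements of $[w]$. For a nontrivial reduced word $w$ and $g\in F$, $C_w(g)$ is the maximum number of disjoint copies of $w$ (as subwords) in the reduced representative of $g$; $\Phi_w(g)=C_w(g)-C_{w^{-1}}(g)$, which is a quasimorphism; and $\phi_w(g)=\lim_{n\to\infty}\Phi_w(g^n)/n$ is its homogenization. *)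

theory Defs
  imports Complex_Main "HOL-Algebra.Group" "HOL-Library.Poly_Mapping"
begin

section \<open>Free groups as groups of reduced words\<close>

text \<open>
  A letter is a pair of a generator and a sign: \<open>(x, True)\<close> is \<open>x\<close> and \<open>(x, False)\<close> is its formal
  inverse. The free group with basis \<open>X\<close> (any set, possibly infinite or empty) has as its elements
  the reduced words over the symmetric generating set \<open>X \<times> UNIV\<close>.
\<close>

type_synonym 'a letter = "'a \<times> bool"
type_synonym 'a word = "'a letter list"

definition inv_letter :: "'a letter \<Rightarrow> 'a letter" where
  "inv_letter a = (fst a, \<not> snd a)"

definition letters :: "'a set \<Rightarrow> 'a letter set" where
  "letters X = X \<times> UNIV"

definition reduced_word :: "'a word \<Rightarrow> bool" where
  "reduced_word w \<longleftrightarrow> successively (\<lambda>a b. b \<noteq> inv_letter a) w"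

text \<open>For reduced \<open>w\<close>, \<open>cancel_cons a w\<close> is the reduced form of the word \<open>a # w\<close>.\<close>

fun cancel_cons :: "'a letter \<Rightarrow> 'a word \<Rightarrow> 'a word" where
  "cancel_cons a [] = [a]"
| "cancel_cons a (b # w) = (if b = inv_letter a then w else a # b # w)"

definition free_group :: "'a set \<Rightarrow> 'a word monoid" where
  "free_group X = \<lparr>carrier = {w. reduced_word w \<and> set w \<subseteq> letters X},
                  monoid.mult = (\<lambda>u v. foldr cancel_cons u v),
                  one = []\<rparr>"

lemma inv_letter_inv_letter [simp]: "inv_letter (inv_letter a) = a"
  by (simp add: inv_letter_def)

lemma inv_letter_neq [simp]: "inv_letter a \<noteq> a" "a \<noteq> inv_letter a"
  by (simp_all add: inv_letter_def prod_eq_iff)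

lemma inv_letter_in_letters [simp]: "inv_letter a \<in> letters X \<longleftrightarrow> a \<in> letters X"
  by (cases a) (simp add: inv_letter_def letters_def)

lemma reduced_Nil [simp]: "reduced_word []"
  by (simp add: reduced_word_def)

lemma reduced_Cons: "reduced_word (a # w) \<longleftrightarrow> (w = [] \<or> hd w \<noteq> inv_letter a) \<and> reduced_word w"
  by (cases w) (auto simp: reduced_word_def)

lemma reduced_cancel_cons: "reduced_word w \<Longrightarrow> reduced_word (cancel_cons a w)"
  by (cases w) (auto simp: reduced_Cons)

lemma set_cancel_cons: "set (cancel_cons a w) \<subseteq> insert a (set w)"
  by (cases w) auto

lemma cancel_cons_eq_Cons: "reduced_word (a # w) \<Longrightarrow> cancel_cons a w = a # w"
  by (cases w) (auto simp: reduced_Cons)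

lemma cancel_cons_inv_letter:
  assumes "reduced_word w"
  shows "cancel_cons a (cancel_cons (inv_letter a) w) = w"
proof (cases w)
  case (Cons b v)
  then show ?thesis
    using assms by (cases "b = a") (auto intro: cancel_cons_eq_Cons)
qed simp

lemma reduced_foldr_cancel_cons: "reduced_word v \<Longrightarrow> reduced_word (foldr cancel_cons u v)"
  by (induction u) (auto intro: reduced_cancel_cons)

lemma set_foldr_cancel_cons: "set (foldr cancel_cons u v) \<subseteq> set u \<union> set v"
proof (induction u)
  case (Cons a u)
  then show ?case using set_cancel_cons[of a "foldr cancel_cons u v"] by auto
qed simp

lemma foldr_cancel_cons_Nil: "reduced_word w \<Longrightarrow> foldr cancel_cons w [] = w"
  by (induction w) (auto simp: reduced_Cons intro!: cancel_cons_eq_Cons)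

lemma foldr_cancel_cons_cancel_cons:
  assumes "reduced_word v"
  shows "foldr cancel_cons (cancel_cons a u) v = cancel_cons a (foldr cancel_cons u v)"
proof (cases u)
  case (Cons b u')
  then show ?thesis
    using cancel_cons_inv_letter[OF reduced_foldr_cancel_cons[OF assms], of a u'] by auto
qed simp

lemma foldr_cancel_cons_assoc:
  assumes "reduced_word w"
  shows "foldr cancel_cons (foldr cancel_cons u v) w = foldr cancel_cons u (foldr cancel_cons v w)"
  by (induction u) (simp_all add: foldr_cancel_cons_cancel_cons[OF assms])

lemma foldr_cancel_cons_rev_inv:
  assumes "reduced_word v"
  shows "foldr cancel_cons (rev (map inv_letter u)) (foldr cancel_cons u v) = v"
  using assms
proof (induction u)
  case (Cons a u)
  then show ?case
    using cancel_cons_inv_letter[of "foldr cancel_cons u v" "inv_letter a"]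
    by (simp add: reduced_foldr_cancel_cons)
qed simp

lemma reduced_rev_map_inv_letter: "reduced_word w \<Longrightarrow> reduced_word (rev (map inv_letter w))"
  unfolding reduced_word_def successively_rev successively_map
  by (auto elim!: successively_mono)

lemma group_free_group: "group (free_group X)"
proof (rule groupI)
  fix w assume w: "w \<in> carrier (free_group X)"
  have "rev (map inv_letter w) \<in> carrier (free_group X)"
    using w by (auto simp: free_group_def reduced_rev_map_inv_letter)
  moreover have "foldr cancel_cons (rev (map inv_letter w)) w = []"
    using foldr_cancel_cons_rev_inv[of "[]" w] w
    by (simp add: free_group_def foldr_cancel_cons_Nil)
  ultimately show "\<exists>y\<in>carrier (free_group X). y \<otimes>\<^bsub>free_group X\<^esub> w = \<one>\<^bsub>free_group X\<^esub>"
    unfolding free_group_def by force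
next
  fix u v assume "u \<in> carrier (free_group X)" "v \<in> carrier (free_group X)"
  then show "u \<otimes>\<^bsub>free_group X\<^esub> v \<in> carrier (free_group X)"
    using set_foldr_cancel_cons[of u v] by (auto simp: free_group_def reduced_foldr_cancel_cons)
qed (simp_all add: free_group_def foldr_cancel_cons_assoc)

lemma inv_free_group:
  assumes "w \<in> carrier (free_group X)"
  shows "inv\<^bsub>free_group X\<^esub> w = rev (map inv_letter w)"
proof (rule group.inv_equality[OF group_free_group])
  show "rev (map inv_letter w) \<otimes>\<^bsub>free_group X\<^esub> w = \<one>\<^bsub>free_group X\<^esub>"
    using foldr_cancel_cons_rev_inv[of "[]" w] assms
    by (simp add: free_group_def foldr_cancel_cons_Nil)
  show "rev (map inv_letter w) \<in> carrier (free_group X)"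
    using assms by (auto simp: free_group_def reduced_rev_map_inv_letter)
qed fact


section \<open>Chains\<close>

text \<open>
  Chains are finitely supported real-valued functions; the basis element of a word \<open>g\<close> is
  \<open>Poly_Mapping.single g 1\<close>. The library provides no scalar multiplication on this type.
\<close>

instantiation poly_mapping :: (type, real_vector) real_vector
begin

lift_definition scaleR_poly_mapping :: "real \<Rightarrow> ('a \<Rightarrow>\<^sub>0 'b) \<Rightarrow> ('a \<Rightarrow>\<^sub>0 'b)"
  is "\<lambda>r c x. r *\<^sub>R c x"
  by (erule finite_subset[rotated]) auto

instance
  by (standard; transfer) (simp_all add: fun_eq_iff scaleR_add_right scaleR_add_left)

end

definition chains :: "'a set \<Rightarrow> ('a word \<Rightarrow>\<^sub>0 real) set" where
  "chains X = span ((\<lambda>g. Poly_Mapping.single g 1) ` carrier (free_group X))"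

definition null_chains :: "'a set \<Rightarrow> ('a word \<Rightarrow>\<^sub>0 real) set" where
  "null_chains X = span
     ({Poly_Mapping.single (g [^]\<^bsub>free_group X\<^esub> n) 1 - real_of_int n *\<^sub>R Poly_Mapping.single g 1
        | g (n::int). g \<in> carrier (free_group X)} \<union>
      {Poly_Mapping.single g 1
         - Poly_Mapping.single (h \<otimes>\<^bsub>free_group X\<^esub> g \<otimes>\<^bsub>free_group X\<^esub> inv\<^bsub>free_group X\<^esub> h) 1
        | g h. g \<in> carrier (free_group X) \<and> h \<in> carrier (free_group X)})"

text \<open>
  The quotient space is the set of cosets \<open>chain_class X ` chains X\<close>; its zero element is
  \<open>chain_class X 0\<close>.
\<close>

definition chain_class :: "'a set \<Rightarrow> ('a word \<Rightarrow>\<^sub>0 real) \<Rightarrow> ('a word \<Rightarrow>\<^sub>0 real) set" where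
  "chain_class X c = {d \<in> chains X. d - c \<in> null_chains X}"


section \<open>Effective words\<close>

definition cyclically_reduced :: "'a word \<Rightarrow> bool" where
  "cyclically_reduced w \<longleftrightarrow> reduced_word w \<and> (w \<noteq> [] \<longrightarrow> last w \<noteq> inv_letter (hd w))"

definition cyclic_class :: "'a word \<Rightarrow> 'a word set" where
  "cyclic_class w = {rotate k w | k. True}"

definition indivisible :: "'a set \<Rightarrow> 'a word \<Rightarrow> bool" where
  "indivisible X w \<longleftrightarrow> w \<in> carrier (free_group X) \<and> w \<noteq> [] \<and>
     \<not> (\<exists>v\<in>carrier (free_group X). \<exists>n\<ge>2::nat. w = v [^]\<^bsub>free_group X\<^esub> n)"

text \<open>
  \<open>r\<close> is a reflexive order on letters; \<^const>\<open>lexord\<close> expects a strict one.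
\<close>

definition lex_le :: "'a letter rel \<Rightarrow> 'a word \<Rightarrow> 'a word \<Rightarrow> bool" where
  "lex_le r u v \<longleftrightarrow> u = v \<or> (u, v) \<in> lexord (r - Id)"

definition effective :: "'a set \<Rightarrow> 'a letter rel \<Rightarrow> 'a word \<Rightarrow> bool" where
  "effective X r w \<longleftrightarrow> indivisible X w \<and> cyclically_reduced w \<and> (\<forall>v\<in>cyclic_class w. lex_le r w v)"


section \<open>Counting quasimorphisms\<close>

definition occurrences :: "'a word \<Rightarrow> 'a word \<Rightarrow> nat set" where
  "occurrences w g = {i. i + length w \<le> length g \<and> take (length w) (drop i g) = w}"

definition disjoint_count :: "'a word \<Rightarrow> 'a word \<Rightarrow> nat" where
  "disjoint_count w g = Max {card P | P. P \<subseteq> occurrences w g \<and>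
     pairwise (\<lambda>i j. i + length w \<le> j \<or> j + length w \<le> i) P}"

definition counting_qm :: "'a set \<Rightarrow> 'a word \<Rightarrow> 'a word \<Rightarrow> real" where
  "counting_qm X w g =
     real (disjoint_count w g) - real (disjoint_count (inv\<^bsub>free_group X\<^esub> w) g)"

definition homog_counting_qm :: "'a set \<Rightarrow> 'a word \<Rightarrow> 'a word \<Rightarrow> real" where
  "homog_counting_qm X w g =
     lim (\<lambda>n. counting_qm X w (g [^]\<^bsub>free_group X\<^esub> (n::nat)) / real n)"

end

theory Submission
  imports Defs
begin

text \<open>
  Modulo powers and conjugation every element is a non-negative multiple of an effective word, and
  the inverse of an effective word \<open>u\<close> is represented by the effective word \<open>e u\<close> conjugate to
  \<open>u\<inverse>\<close>. So a chain \<open>\<Sum>\<^sub>i g\<^sub>i\<close> equals \<open>\<Sum>\<^sub>i n\<^sub>i u\<^sub>i\<close>, and twice this chain equals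
  \<open>\<Sum>\<^sub>v c(v) v\<close>, where \<open>c(v)\<close> is the total multiplicity of \<open>v\<close> minus that of \<open>e v\<close>. If the chain
  is not zero, then some integer \<open>c(v)\<close> is not zero. Take such a \<open>v\<close> of maximal length; since
  \<open>c(e v) = - c(v)\<close>, replacing \<open>v\<close> by \<open>e v\<close> if necessary makes \<open>c(v) \<ge> 1\<close>.

  The point is that \<open>\<phi>\<^sub>v\<close> can be computed on effective words that are no longer than \<open>v\<close>. An
  effective word is a Lyndon word and hence has no border: no proper non-empty prefix of it is also
  a suffix (\<open>unbordered_if_primitive_minimal\<close>). This has two consequences. Copies of \<open>v\<close> never
  overlap, so that \<open>C\<^sub>v\<close> counts all occurrences, and \<open>\<phi>\<^sub>v(u)\<close> is the number of occurrences of \<open>v\<close>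
  in the cyclic word \<open>u\<close> minus the number of those of \<open>v\<inverse>\<close>
  (\<open>homog_counting_qm_conjugate_power\<close>). And \<open>v\<close> does not occur in a periodic word whose period is
  shorter than \<open>v\<close>, so that for \<open>u\<close> not longer than \<open>v\<close> it occurs in the cyclic word \<open>u\<close> only if
  \<open>u = v\<close>, and then once (\<open>cyclic_count_effective\<close>). By maximality, longer words have coefficient
  \<open>0\<close>, so \<open>2 \<Sum>\<^sub>i \<phi>\<^sub>v(g\<^sub>i) = c(v) - c(e v) = 2 c(v) \<ge> 2\<close>.
\<close>

section \<open>Words and powers in the free group\<close>

abbreviation inv_word :: "'a word \<Rightarrow> 'a word" where
  "inv_word w \<equiv> rev (map inv_letter w)"

abbreviation word_power :: "'a list \<Rightarrow> nat \<Rightarrow> 'a list" where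
  "word_power w n \<equiv> concat (replicate n w)"

lemma inv_word_inv_word [simp]: "inv_word (inv_word w) = w"
  by (simp add: rev_map[symmetric] o_def)

lemma carrier_free_group: "w \<in> carrier (free_group X) \<longleftrightarrow> reduced_word w \<and> set w \<subseteq> letters X"
  by (simp add: free_group_def)

lemma set_inv_word: "set (inv_word w) \<subseteq> letters X \<longleftrightarrow> set w \<subseteq> letters X"
  by auto

lemma reduced_append:
  "reduced_word (u @ v) \<longleftrightarrow>
     reduced_word u \<and> reduced_word v \<and> (u = [] \<or> v = [] \<or> hd v \<noteq> inv_letter (last u))"
  by (simp add: reduced_word_def successively_append_iff)

lemma mult_free_group_append:
  assumes "reduced_word (u @ v)"
  shows "u \<otimes>\<^bsub>free_group X\<^esub> v = u @ v"
proof -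
  have "foldr cancel_cons u v = u @ v"
    using assms by (induction u) (auto simp: reduced_Cons intro!: cancel_cons_eq_Cons)
  then show ?thesis by (simp add: free_group_def)
qed

lemma cyclically_reduced_append_commute:
  "cyclically_reduced (u @ v) \<Longrightarrow> cyclically_reduced (v @ u)"
  by (cases "u = []"; cases "v = []") (auto simp: cyclically_reduced_def reduced_append)

lemma cyclically_reduced_rotate: "cyclically_reduced w \<Longrightarrow> cyclically_reduced (rotate k w)"
  unfolding rotate_drop_take
  by (rule cyclically_reduced_append_commute) simp

lemma cyclically_reduced_iff_reduced_square: "cyclically_reduced w \<longleftrightarrow> reduced_word (w @ w)"
  by (auto simp: cyclically_reduced_def reduced_append)

lemma cyclically_reduced_inv_word:
  "cyclically_reduced w \<Longrightarrow> cyclically_reduced (inv_word w)"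
  unfolding cyclically_reduced_iff_reduced_square
  by (metis reduced_rev_map_inv_letter map_append rev_append)

lemma word_power_Suc_nonempty:
  assumes "w \<noteq> []"
  shows "word_power w (Suc n) \<noteq> []" "hd (word_power w (Suc n)) = hd w"
    "last (word_power w (Suc n)) = last w"
proof -
  show "word_power w (Suc n) \<noteq> []" "hd (word_power w (Suc n)) = hd w"
    using assms by auto
  show "last (word_power w (Suc n)) = last w"
    using assms by (induction n) auto
qed

lemma cyclically_reduced_word_power:
  assumes "cyclically_reduced w"
  shows "cyclically_reduced (word_power w n)"
proof (cases "w = [] \<or> n = 0")
  case True
  then show ?thesis by (auto simp: cyclically_reduced_def)
next
  case False
  then obtain m where n: "n = Suc m" by (cases n) auto
  have w: "reduced_word w" "w \<noteq> []" "hd w \<noteq> inv_letter (last w)"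
    using assms False by (auto simp: cyclically_reduced_iff_reduced_square reduced_append)
  have "reduced_word (word_power w (Suc m))"
  proof (induction m)
    case (Suc m)
    have "word_power w (Suc (Suc m)) = w @ word_power w (Suc m)" by simp
    then show ?case
      using Suc w word_power_Suc_nonempty[OF w(2), of m] by (simp only: reduced_append) simp
  qed (use w in simp)
  then show ?thesis
    using assms w word_power_Suc_nonempty[OF w(2), of m] n
    by (simp only: cyclically_reduced_def)
qed

lemma cyclically_reduced_if_word_power:
  assumes "cyclically_reduced (word_power w n)" "n \<noteq> 0"
  shows "cyclically_reduced w"
proof -
  obtain m where n: "n = Suc m" using assms(2) by (cases n) auto
  show ?thesis
  proof (cases "w = []")
    case False
    then show ?thesis
      using assms word_power_Suc_nonempty[OF False, of m]
      unfolding cyclically_reduced_def n by (auto simp: reduced_append)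
  qed (simp add: cyclically_reduced_def)
qed

text \<open>
  Stripping matching first and last letters off a reduced word exhibits it as a conjugate, without
  any cancellation, of a cyclically reduced word.
\<close>

lemma reduced_eq_conjugate_cyclically_reduced:
  assumes "reduced_word g" "g \<noteq> []"
  obtains h t where "g = h @ t @ inv_word h" "t \<noteq> []" "cyclically_reduced t"
  using assms
proof (induction "length g" arbitrary: g thesis rule: less_induct)
  case less
  show ?case
  proof (cases "cyclically_reduced g")
    case True
    then show ?thesis using less.prems(1)[of "[]" g] less.prems(3) by simp
  next
    case False
    then have last: "last g = inv_letter (hd g)"
      using less.prems by (auto simp: cyclically_reduced_def)
    obtain a g1 where g: "g = a # g1" using less.prems(3) by (cases g) auto
    have "g1 \<noteq> []" using last g by auto
    then obtain g' where g1: "g1 = g' @ [inv_letter a]"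
      using last g by (cases g1 rule: rev_cases) auto
    have "g' \<noteq> []" using less.prems(2) g g1 by (auto simp: reduced_Cons)
    moreover have "reduced_word g'" using less.prems(2) g g1 by (simp add: reduced_Cons reduced_append)
    moreover have "length g' < length g" using g g1 by simp
    ultimately obtain h t where "g' = h @ t @ inv_word h" "t \<noteq> []" "cyclically_reduced t"
      using less.hyps by blast
    then show ?thesis using less.prems(1)[of "a # h" t] g g1 by simp
  qed
qed

lemma reduced_conjugate_word_power:
  assumes "reduced_word (h @ t @ inv_word h)" "cyclically_reduced t" "t \<noteq> []"
  shows "reduced_word (h @ word_power t (Suc n) @ inv_word h)"
  using assms cyclically_reduced_word_power[OF assms(2), of "Suc n"]
    word_power_Suc_nonempty[OF assms(3), of n]
  by (auto simp only: reduced_append cyclically_reduced_def hd_append last_append split: if_splits)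

lemma conjugate_free_group_append:
  assumes h: "h \<in> carrier (free_group X)" and red: "reduced_word (h @ t @ inv_word h)"
  shows "h @ t @ inv_word h = h \<otimes>\<^bsub>free_group X\<^esub> t \<otimes>\<^bsub>free_group X\<^esub> inv\<^bsub>free_group X\<^esub> h"
proof -
  have "reduced_word ((h @ t) @ inv_word h)" using red by (simp only: append_assoc)
  moreover from this have "reduced_word (h @ t)"
    unfolding reduced_append[of "h @ t"] by blast
  ultimately show ?thesis
    by (simp only: mult_free_group_append inv_free_group[OF h] append_assoc)
qed

text \<open>
  With a cyclically reduced core, powers of \<open>h t h\<inverse>\<close> involve no cancellation beyond the inner
  \<open>h\<inverse> h\<close>, so their reduced words are periodic up to the fixed ends.
\<close>

lemma nat_pow_conjugate:
  assumes "h @ t @ inv_word h \<in> carrier (free_group X)" "cyclically_reduced t" "t \<noteq> []"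
  shows "(h @ t @ inv_word h) [^]\<^bsub>free_group X\<^esub> Suc n = h @ word_power t (Suc n) @ inv_word h"
proof -
  interpret group "free_group X" by (rule group_free_group)
  let ?g = "h @ t @ inv_word h" and ?F = "free_group X"
  have red: "reduced_word ?g" and sub: "set h \<subseteq> letters X" "set t \<subseteq> letters X"
    using assms(1) by (auto simp: carrier_free_group)
  have h: "h \<in> carrier ?F" using red sub by (simp add: carrier_free_group reduced_append)
  have conj: "h @ word_power t (Suc k) @ inv_word h
      = h \<otimes>\<^bsub>?F\<^esub> word_power t (Suc k) \<otimes>\<^bsub>?F\<^esub> inv\<^bsub>?F\<^esub> h" for k
    by (rule conjugate_free_group_append[OF h reduced_conjugate_word_power[OF red assms(2,3)]])
  have pow: "word_power t k \<in> carrier ?F" for k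
    using cyclically_reduced_word_power[OF assms(2), of k] sub
    by (auto simp: carrier_free_group cyclically_reduced_def)
  have snoc: "word_power t (Suc k) = word_power t k @ t" for k
    by (induction k) auto
  have t: "t \<in> carrier ?F" using pow[of 1] by simp
  show ?thesis
  proof (induction n)
    case 0
    show ?case using assms(1) by (simp del: append_assoc)
  next
    case (Suc n)
    have red': "reduced_word (word_power t (Suc n) @ t)"
      using pow[of "Suc (Suc n)"] snoc[of "Suc n"] by (simp only: carrier_free_group)
    have "?g [^]\<^bsub>?F\<^esub> Suc (Suc n) = (h @ word_power t (Suc n) @ inv_word h) \<otimes>\<^bsub>?F\<^esub> ?g"
      using Suc by simp
    also have "\<dots> = (h \<otimes>\<^bsub>?F\<^esub> word_power t (Suc n) \<otimes>\<^bsub>?F\<^esub> inv\<^bsub>?F\<^esub> h)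
                    \<otimes>\<^bsub>?F\<^esub> (h \<otimes>\<^bsub>?F\<^esub> t \<otimes>\<^bsub>?F\<^esub> inv\<^bsub>?F\<^esub> h)"
      using conj[of n] conj[of 0] by simp
    also have "\<dots> = h \<otimes>\<^bsub>?F\<^esub> (word_power t (Suc n) \<otimes>\<^bsub>?F\<^esub> t) \<otimes>\<^bsub>?F\<^esub> inv\<^bsub>?F\<^esub> h"
      using h pow[of "Suc n"] t by (simp add: m_assoc inv_solve_left' del: replicate_Suc)
    also have "word_power t (Suc n) \<otimes>\<^bsub>?F\<^esub> t = word_power t (Suc (Suc n))"
      using mult_free_group_append[OF red'] snoc[of "Suc n"] by simp
    finally show ?case using conj[of "Suc n"] by simp
  qed
qed

lemma nat_pow_cyclically_reduced:
  assumes "t \<in> carrier (free_group X)" "cyclically_reduced t"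
  shows "t [^]\<^bsub>free_group X\<^esub> n = word_power t n"
proof (cases n)
  case 0
  then show ?thesis by (simp add: free_group_def)
next
  case (Suc m)
  interpret group "free_group X" by (rule group_free_group)
  show ?thesis
  proof (cases "t = []")
    case True
    then have "t = \<one>\<^bsub>free_group X\<^esub>" by (simp add: free_group_def)
    then show ?thesis using True nat_pow_one[of n] by simp
  next
    case False
    then show ?thesis using nat_pow_conjugate[of "[]" t X m] assms Suc by simp
  qed
qed

lemma rotate_eq_conjugate:
  assumes "w \<in> carrier (free_group X)" "cyclically_reduced w"
  obtains h where "h \<in> carrier (free_group X)"
    "rotate k w = h \<otimes>\<^bsub>free_group X\<^esub> w \<otimes>\<^bsub>free_group X\<^esub> inv\<^bsub>free_group X\<^esub> h"
proof -
  interpret group "free_group X" by (rule group_free_group)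
  let ?F = "free_group X"
  define u where "u = take (k mod length w) w"
  define v where "v = drop (k mod length w) w"
  have w: "w = u @ v" and rot: "rotate k w = v @ u"
    by (simp_all add: u_def v_def rotate_drop_take)
  have "reduced_word (v @ u)"
    using cyclically_reduced_rotate[OF assms(2), of k] rot by (simp add: cyclically_reduced_def)
  moreover have red: "reduced_word (u @ v)" using assms w by (simp add: carrier_free_group)
  ultimately have mult: "w = u \<otimes>\<^bsub>?F\<^esub> v" "rotate k w = v \<otimes>\<^bsub>?F\<^esub> u"
    using w rot by (simp_all add: mult_free_group_append)
  have u: "u \<in> carrier ?F" and v: "v \<in> carrier ?F"
    using assms(1) w by (simp_all add: carrier_free_group reduced_append)
  have "inv\<^bsub>?F\<^esub> u \<otimes>\<^bsub>?F\<^esub> (u \<otimes>\<^bsub>?F\<^esub> (v \<otimes>\<^bsub>?F\<^esub> u)) = v \<otimes>\<^bsub>?F\<^esub> u"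
    using u v by (simp add: m_assoc[symmetric])
  then have "rotate k w = inv\<^bsub>?F\<^esub> u \<otimes>\<^bsub>?F\<^esub> w \<otimes>\<^bsub>?F\<^esub> inv\<^bsub>?F\<^esub> (inv\<^bsub>?F\<^esub> u)"
    using u v mult by (simp add: m_assoc)
  then show ?thesis using that[of "inv\<^bsub>?F\<^esub> u"] u by blast
qed

section \<open>Primitive words and effective words\<close>

text \<open>
  Equivalently, \<open>w\<close> is not a proper power (\<open>primitive_not_word_power\<close> and
  \<open>not_primitive_eq_word_power\<close>). In terms of rotations the notion is visibly invariant under
  rotation.
\<close>

definition primitive :: "'a list \<Rightarrow> bool" where
  "primitive w \<longleftrightarrow> w \<noteq> [] \<and> (\<forall>k. 0 < k \<and> k < length w \<longrightarrow> rotate k w \<noteq> w)"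

definition unbordered :: "'a list \<Rightarrow> bool" where
  "unbordered w \<longleftrightarrow> (\<forall>k. 0 < k \<and> k < length w \<longrightarrow> take (length w - k) w \<noteq> drop k w)"

lemma length_word_power [simp]: "length (word_power w n) = n * length w"
  by (induction n) auto

lemma word_power_word_power: "word_power (word_power w m) n = word_power w (n * m)"
  by (induction n) (simp_all add: replicate_add)

lemma primitive_not_word_power:
  assumes "primitive (word_power w n)"
  shows "n = 1"
proof (rule ccontr)
  assume "n \<noteq> 1"
  moreover have "n \<noteq> 0" "w \<noteq> []" using assms by (auto simp: primitive_def)
  ultimately obtain m where n: "n = Suc (Suc m)"
    by (metis One_nat_def not0_implies_Suc)
  have "word_power w (Suc m) @ w = word_power w n"
    unfolding n by (induction m) auto
  then have "rotate (length w) (word_power w n) = word_power w n"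
    using rotate_append[of w "word_power w (Suc m)"] n by simp
  moreover have "0 < length w" "length w < length (word_power w n)"
    using \<open>w \<noteq> []\<close> n by auto
  ultimately show False using assms unfolding primitive_def by blast
qed

text \<open>
  A word fixed by a proper rotation is a product of two commuting words, and these are powers of a
  common word.
\<close>

lemma not_primitive_eq_word_power:
  assumes "w \<noteq> []" "\<not> primitive w"
  obtains v n where "n \<ge> 2" "w = word_power v n"
proof -
  obtain k where k: "0 < k" "k < length w" "rotate k w = w"
    using assms by (auto simp: primitive_def)
  then have "drop k w @ take k w = take k w @ drop k w"
    by (simp add: rotate_drop_take)
  moreover have "drop k w \<noteq> []" "take k w \<noteq> []" using k by auto
  ultimately obtain n v where "n > 1" "word_power v n = take k w @ drop k w"
    using comm_append_is_replicate[of "take k w" "drop k w"] by metis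
  then show ?thesis using that[of n v] by simp
qed

lemma primitive_root:
  assumes "w \<noteq> []"
  obtains v n where "primitive v" "n \<noteq> 0" "w = word_power v n"
  using assms
proof (induction "length w" arbitrary: w thesis rule: less_induct)
  case less
  show ?case
  proof (cases "primitive w")
    case True
    then show ?thesis using less.prems(1)[of w 1] by simp
  next
    case False
    obtain v n where v: "n \<ge> 2" "w = word_power v n"
      using less.prems(2) False by (rule not_primitive_eq_word_power)
    have "v \<noteq> []" using v less.prems(2) by auto
    moreover have "length v < length w" using v \<open>v \<noteq> []\<close> by (cases n) auto
    ultimately obtain u m where "primitive u" "m \<noteq> 0" "v = word_power u m"
      using less.hyps by blast
    then show ?thesis using less.prems(1)[of u "n * m"] v by (simp add: word_power_word_power)
  qed
qed

lemma primitive_rotate: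
  assumes "primitive w"
  shows "primitive (rotate j w)"
proof -
  have inj: "inj (rotate j)"
    unfolding rotate_def by (rule inj_fn[OF inj_rotate1])
  have "rotate k (rotate j w) \<noteq> rotate j w" if k: "0 < k" "k < length w" for k
  proof
    assume "rotate k (rotate j w) = rotate j w"
    then have "rotate j (rotate k w) = rotate j w" by (simp add: rotate_rotate add.commute)
    then have "rotate k w = w" by (rule injD[OF inj])
    then show False using assms k unfolding primitive_def by blast
  qed
  moreover have "rotate j w \<noteq> []" using assms by (simp add: primitive_def)
  ultimately show ?thesis unfolding primitive_def length_rotate by blast
qed

lemma primitive_inv_word:
  assumes "primitive w"
  shows "primitive (inv_word w)"
proof (rule ccontr)
  assume not_primitive: "\<not> primitive (inv_word w)"
  have "inv_word w \<noteq> []" using assms by (simp add: primitive_def)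
  then obtain v n where v: "n \<ge> 2" "inv_word w = word_power v n"
    using not_primitive by (rule not_primitive_eq_word_power)
  have "inv_word (inv_word w) = word_power (inv_word v) n"
    unfolding v(2) by (simp add: map_concat rev_concat)
  then have "primitive (word_power (inv_word v) n)"
    using assms unfolding inv_word_inv_word by (simp only:)
  then show False using primitive_not_word_power[of n "inv_word v"] v(1) by simp
qed

text \<open>
  For cyclically reduced words, powers in the group are powers of words: a power of a word with
  non-empty conjugating prefix still has that prefix, so it is not cyclically reduced.
\<close>

lemma indivisible_iff_primitive:
  assumes w: "w \<in> carrier (free_group X)" "cyclically_reduced w"
  shows "indivisible X w \<longleftrightarrow> primitive w"
proof
  assume ind: "indivisible X w"
  show "primitive w"
  proof (rule ccontr)
    assume not_primitive: "\<not> primitive w"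
    have "w \<noteq> []" using ind by (simp add: indivisible_def)
    then obtain v n where v: "n \<ge> 2" "w = word_power v n"
      using not_primitive by (rule not_primitive_eq_word_power)
    have cyc: "cyclically_reduced v" using cyclically_reduced_if_word_power[of n v] w v by simp
    have "set v \<subseteq> set w" using v by (cases n) auto
    then have "v \<in> carrier (free_group X)"
      using w(1) cyc by (auto simp: carrier_free_group cyclically_reduced_def)
    moreover from this have "w = v [^]\<^bsub>free_group X\<^esub> n"
      using nat_pow_cyclically_reduced[OF _ cyc] v(2) by metis
    ultimately show False using ind v(1) unfolding indivisible_def by blast
  qed
next
  assume prim: "primitive w"
  have False if v: "v \<in> carrier (free_group X)" "n \<ge> 2" "w = v [^]\<^bsub>free_group X\<^esub> n" for v and n :: nat
  proof -
    obtain m where n: "n = Suc m" using v(2) by (cases n) auto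
    have "w \<noteq> []" using prim by (simp add: primitive_def)
    then have "v \<noteq> []"
      using v nat_pow_cyclically_reduced[of "[]" X n] by (auto simp: cyclically_reduced_def)
    then obtain h t where g: "v = h @ t @ inv_word h" "t \<noteq> []" "cyclically_reduced t"
      using v reduced_eq_conjugate_cyclically_reduced[of v] by (auto simp: carrier_free_group)
    then have w_eq: "w = h @ word_power t n @ inv_word h"
      using nat_pow_conjugate[of h t X m] v n by simp
    have "h = []"
    proof (cases h)
      case (Cons a h')
      then have "hd w = a" "last w = inv_letter a" using w_eq by simp_all
      then show ?thesis using w(2) \<open>w \<noteq> []\<close> by (simp add: cyclically_reduced_def)
    qed
    then have "w = word_power t n" using w_eq by simp
    then show False using primitive_not_word_power[of n t] prim v(2) by simp
  qed
  then show "indivisible X w" using w prim unfolding indivisible_def primitive_def by blast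
qed

lemma effective_iff:
  "effective X r w \<longleftrightarrow> w \<in> carrier (free_group X) \<and> cyclically_reduced w \<and> primitive w \<and>
     (\<forall>k. lex_le r w (rotate k w))"
  using indivisible_iff_primitive[of w X]
  by (auto simp: effective_def cyclic_class_def indivisible_def)

lemma lexord_antisym:
  assumes "antisym r" "(u, v) \<in> lexord (r - Id)" "(v, u) \<in> lexord (r - Id)"
  shows False
proof -
  have "asym (r - Id)" using assms(1) by (auto simp: antisym_def intro: asymI)
  then show False using assms(2,3) lexord_asymmetric by blast
qed

lemma lexord_total_on_same_length:
  assumes "total_on A r" "length u = length v" "set u \<subseteq> A" "set v \<subseteq> A"
  shows "u = v \<or> (u, v) \<in> lexord (r - Id) \<or> (v, u) \<in> lexord (r - Id)"
  using assms(2-)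
proof (induction u v rule: list_induct2)
  case (Cons a u b v)
  then show ?case using assms(1) unfolding total_on_def by auto
qed simp

text \<open>
  If \<open>w = u x = y u\<close> with all these factors non-empty, minimality of \<open>w\<close> against the rotations
  \<open>u y\<close> and \<open>x u\<close> gives \<open>x \<le> y\<close> and \<open>y \<le> x\<close>. So \<open>u\<close> and \<open>x\<close> commute, and \<open>w\<close> is
  fixed by a proper rotation.
\<close>

lemma unbordered_if_primitive_minimal:
  assumes r: "antisym r" and w: "primitive w" "\<And>k. lex_le r w (rotate k w)"
  shows "unbordered w"
  unfolding unbordered_def
proof (intro allI impI notI)
  fix k assume k: "0 < k \<and> k < length w" and border: "take (length w - k) w = drop k w"
  define u x y where "u = drop k w" and "x = drop (length w - k) w" and "y = take k w"
  have ux: "w = u @ x" unfolding u_def x_def border[symmetric] by simp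
  have yu: "w = y @ u" by (simp add: u_def y_def)
  have len: "length x = length y" using k by (simp add: x_def y_def)
  have "rotate (length u) w = x @ u" unfolding ux by (rule rotate_append)
  moreover have "rotate (length y) w = u @ y" unfolding yu by (rule rotate_append)
  ultimately have le: "lex_le r (u @ x) (u @ y)" "lex_le r (y @ u) (x @ u)"
    using w(2)[of "length y"] w(2)[of "length u"] ux yu by simp_all
  have "x = y"
  proof (rule ccontr)
    assume neq: "x \<noteq> y"
    then have "(x, y) \<in> lexord (r - Id)"
      using le(1) lexord_append_leftD[of u x y "r - Id"] by (auto simp: lex_le_def)
    moreover have "(y, x) \<in> lexord (r - Id)"
      using le(2) neq len lexord_sufE[of y u x u "r - Id"] by (auto simp: lex_le_def)
    ultimately show False using lexord_antisym[OF r] by blast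
  qed
  then have "rotate (length u) w = w" using \<open>rotate (length u) w = x @ u\<close> yu by simp
  moreover have "0 < length u" "length u < length w" using k by (auto simp: u_def)
  ultimately show False using w(1) unfolding primitive_def by blast
qed

lemma unbordered_inv_word:
  assumes "unbordered w"
  shows "unbordered (inv_word w)"
  unfolding unbordered_def
proof (intro allI impI notI)
  fix k assume k: "0 < k \<and> k < length (inv_word w)"
    and border: "take (length (inv_word w) - k) (inv_word w) = drop k (inv_word w)"
  have "inv_word (drop k w) = inv_word (take (length w - k) w)"
    using border k by (simp add: take_rev drop_rev take_map drop_map)
  then have "drop k w = take (length w - k) w"
    by (metis inv_word_inv_word)
  then show False using assms k unfolding unbordered_def by (metis length_map length_rev)
qed

lemma rotate_inverse:
  obtains j where "rotate j (rotate k w) = w"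
proof -
  have "rotate (length w - k mod length w) (rotate k w) = rotate (length w) w"
  proof (cases "w = []")
    case False
    then have "length w - k mod length w + k mod length w = length w"
      by (simp add: less_imp_le)
    then show ?thesis using rotate_conv_mod[of k w] by (simp add: rotate_rotate)
  qed simp
  then show ?thesis using that by simp
qed

lemma effective_rotation_unique:
  assumes "antisym r" "effective X r u" "effective X r v" "v = rotate k u"
  shows "u = v"
proof (rule ccontr)
  assume "u \<noteq> v"
  obtain j where "u = rotate j v" using rotate_inverse assms(4) by metis
  then have "(u, v) \<in> lexord (r - Id)" "(v, u) \<in> lexord (r - Id)"
    using assms \<open>u \<noteq> v\<close> unfolding effective_iff lex_le_def by metis+
  then show False using lexord_antisym[OF assms(1)] by blast
qed

lemma effective_rotation_exists:
  assumes r: "linear_order_on (letters X) r"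
    and w: "w \<in> carrier (free_group X)" "cyclically_reduced w" "primitive w"
  obtains k where "effective X r (rotate k w)"
proof -
  let ?A = "range (\<lambda>k. rotate k w)" and ?R = "\<lambda>u v. (u, v) \<in> lexord (r - Id)"
  have asym: "antisym r" and trans: "trans r" and tot: "total_on (letters X) r"
    using r unfolding linear_order_on_def partial_order_on_def preorder_on_def by auto
  have "?A = (\<lambda>k. rotate k w) ` {..<length w}"
  proof (intro subset_antisym subsetI)
    fix v assume "v \<in> ?A"
    then obtain k where "v = rotate (k mod length w) w" using rotate_conv_mod by blast
    then show "v \<in> (\<lambda>k. rotate k w) ` {..<length w}" using w(3) by (auto simp: primitive_def)
  qed auto
  then have fin: "finite ?A" by simp
  have "trans (r - Id)" using trans asym by (rule trans_diff_Id)
  then have tr: "transp_on ?A ?R"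
    by (intro transp_onI) (metis lexord_trans)
  have as: "asymp_on ?A ?R"
    using lexord_antisym[OF asym] by (intro asymp_onI) blast
  obtain k where k: "\<forall>x\<in>?A. x \<noteq> rotate k w \<longrightarrow> \<not> ?R x (rotate k w)"
    using Finite_Set.bex_min_element[OF fin as tr] by auto
  have "lex_le r (rotate k w) (rotate j w)" for j
  proof -
    have "rotate j w \<noteq> rotate k w \<longrightarrow> \<not> ?R (rotate j w) (rotate k w)" using k by blast
    then show ?thesis
      using lexord_total_on_same_length[OF tot, of "rotate k w" "rotate j w"] w(1)
      unfolding lex_le_def by (auto simp: carrier_free_group)
  qed
  then have "lex_le r (rotate k w) (rotate j (rotate k w))" for j
    by (simp add: rotate_rotate)
  moreover have "rotate k w \<in> carrier (free_group X)"
    using w cyclically_reduced_rotate[OF w(2), of k]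
    by (simp add: carrier_free_group cyclically_reduced_def)
  ultimately have "effective X r (rotate k w)"
    using cyclically_reduced_rotate[OF w(2)] primitive_rotate[OF w(3)] unfolding effective_iff
    by (intro conjI allI)
  then show ?thesis by (rule that)
qed

lemma effective_unbordered: "antisym r \<Longrightarrow> effective X r w \<Longrightarrow> unbordered w"
  by (rule unbordered_if_primitive_minimal[of r]) (simp_all add: effective_iff)

text \<open>
  The inverse of an effective word need not be minimal among its rotations; this picks the rotation
  that is. It is unique by \<open>effective_rotation_unique\<close>.
\<close>

definition effective_inverse :: "'a set \<Rightarrow> 'a letter rel \<Rightarrow> 'a word \<Rightarrow> 'a word" where
  "effective_inverse X r w = (SOME v. effective X r v \<and> (\<exists>k. v = rotate k (inv_word w)))"

lemma effective_inverse:
  assumes "linear_order_on (letters X) r" "effective X r w"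
  shows "effective X r (effective_inverse X r w)"
    and "\<exists>k. effective_inverse X r w = rotate k (inv_word w)"
proof -
  have w: "w \<in> carrier (free_group X)" "cyclically_reduced w" "primitive w"
    using assms(2) by (simp_all add: effective_iff)
  have "inv_word w \<in> carrier (free_group X)"
    using w(1) reduced_rev_map_inv_letter[of w] unfolding carrier_free_group set_inv_word by simp
  then obtain k where "effective X r (rotate k (inv_word w))"
    using cyclically_reduced_inv_word[OF w(2)] primitive_inv_word[OF w(3)]
    by (rule effective_rotation_exists[OF assms(1)])
  then have "\<exists>v. effective X r v \<and> (\<exists>k. v = rotate k (inv_word w))" by blast
  then have "effective X r (effective_inverse X r w) \<and>
      (\<exists>k. effective_inverse X r w = rotate k (inv_word w))"
    unfolding effective_inverse_def by (rule someI_ex)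
  then show "effective X r (effective_inverse X r w)"
    "\<exists>k. effective_inverse X r w = rotate k (inv_word w)"
    by simp_all
qed

lemma length_effective_inverse:
  assumes "linear_order_on (letters X) r" "effective X r w"
  shows "length (effective_inverse X r w) = length w"
  using effective_inverse(2)[OF assms] by auto

lemma inv_word_rotate: "\<exists>j. inv_word (rotate k w) = rotate j (inv_word w)"
proof -
  obtain u v where uv: "w = u @ v" "rotate k w = v @ u"
    by (metis append_take_drop_id rotate_drop_take)
  have "inv_word (rotate k w) = rotate (length (inv_word v)) (inv_word w)"
    unfolding uv(2) unfolding uv(1) by (simp only: map_append rev_append rotate_append)
  then show ?thesis by blast
qed

lemma effective_inverse_involution:
  assumes r: "linear_order_on (letters X) r" and w: "effective X r w"
  shows "effective_inverse X r (effective_inverse X r w) = w"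
proof -
  let ?e = "effective_inverse X r"
  obtain k where k: "?e w = rotate k (inv_word w)" using effective_inverse(2)[OF r w] by blast
  obtain j where j: "?e (?e w) = rotate j (inv_word (?e w))"
    using effective_inverse(2)[OF r effective_inverse(1)[OF r w]] by blast
  obtain i where "inv_word (?e w) = rotate i w"
    using inv_word_rotate[of k "inv_word w"] unfolding k inv_word_inv_word by blast
  then have "?e (?e w) = rotate (j + i) w" using j by (simp add: rotate_rotate)
  moreover have "effective X r (?e (?e w))" using effective_inverse(1) r w by blast
  moreover have "antisym r" using r unfolding linear_order_on_def partial_order_on_def by blast
  ultimately show ?thesis using effective_rotation_unique[OF _ w] by metis
qed

section \<open>Occurrences in powers\<close>

definition periodic_nth :: "'a list \<Rightarrow> nat \<Rightarrow> 'a" where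
  "periodic_nth u i = u ! (i mod length u)"

definition matches_at :: "'a list \<Rightarrow> 'a list \<Rightarrow> nat \<Rightarrow> bool" where
  "matches_at w u i \<longleftrightarrow> (\<forall>j<length w. periodic_nth u (i + j) = w ! j)"

text \<open>
  Starting positions within one period are counted, but an occurrence may be longer than \<open>u\<close> and
  wrap around it several times.
\<close>

definition cyclic_count :: "'a list \<Rightarrow> 'a list \<Rightarrow> nat" where
  "cyclic_count w u = (\<Sum>i<length u. of_bool (matches_at w u i))"

lemma sum_shift_periodic:
  fixes f :: "nat \<Rightarrow> nat"
  assumes periodic: "\<And>i. f (i + L) = f i"
  shows "(\<Sum>i<m * L. f (i + a)) = m * (\<Sum>i<L. f i)"
proof -
  have window: "(\<Sum>i<L. f (i + a)) = (\<Sum>i<L. f i)" for a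
  proof (induction a)
    case (Suc a)
    have "f a + (\<Sum>i<L. f (Suc i + a)) = (\<Sum>i<Suc L. f (i + a))"
      by (subst sum.lessThan_Suc_shift) simp
    also have "\<dots> = (\<Sum>i<L. f (i + a)) + f a"
      using periodic[of a] by (simp add: add.commute)
    finally show ?case using Suc by simp
  qed simp
  show ?thesis
  proof (induction m)
    case (Suc m)
    have "(\<Sum>i<m * L + k. f (i + a)) = (\<Sum>i<m * L. f (i + a)) + (\<Sum>i<k. f (i + (m * L + a)))"
      for k by (induction k) (simp_all add: add_ac)
    note this[of L]
    then show ?case using Suc window[of "m * L + a"] by (simp add: add.commute)
  qed simp
qed

lemma matches_at_periodic: "matches_at w u (i + length u) = matches_at w u i"
proof -
  have "periodic_nth u (i + length u + j) = periodic_nth u (i + j)" for j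
    using mod_add_self2[of "i + j" "length u"] by (simp add: periodic_nth_def add_ac)
  then show ?thesis by (simp add: matches_at_def)
qed

lemma sum_matches_at_shift:
  "(\<Sum>i<m * length u. of_bool (matches_at w u (i + a))) = m * cyclic_count w u"
  unfolding cyclic_count_def
  by (rule sum_shift_periodic) (simp add: matches_at_periodic)

lemma periodic_nth_rotate:
  assumes "u \<noteq> []"
  shows "periodic_nth (rotate k u) i = periodic_nth u (i + k)"
  using assms by (simp add: periodic_nth_def nth_rotate mod_add_right_eq add.commute)

lemma cyclic_count_rotate: "cyclic_count w (rotate k u) = cyclic_count w u"
proof (cases "u = []")
  case False
  have "matches_at w (rotate k u) i = matches_at w u (i + k)" for i
    by (simp add: matches_at_def periodic_nth_rotate[OF False] add_ac)
  then show ?thesis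
    using sum_matches_at_shift[of w u k 1] by (simp add: cyclic_count_def)
qed simp

lemma nth_word_power:
  assumes "i < n * length u"
  shows "word_power u n ! i = periodic_nth u i"
  using assms
proof (induction n arbitrary: i)
  case (Suc n)
  then show ?case
    by (cases "i < length u") (simp_all add: nth_append periodic_nth_def le_mod_geq)
qed simp

lemma periodic_nth_word_power:
  assumes "u \<noteq> []" "n \<noteq> 0"
  shows "periodic_nth (word_power u n) i = periodic_nth u i"
proof -
  have "i mod (n * length u) < n * length u" using assms by simp
  then have "periodic_nth (word_power u n) i = periodic_nth u (i mod (n * length u))"
    using nth_word_power by (simp add: periodic_nth_def)
  then show ?thesis by (simp add: periodic_nth_def mod_mod_cancel)
qed

lemma periodic_nth_inv_word:
  assumes "u \<noteq> []" "length u dvd Suc (i + j)"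
  shows "periodic_nth (inv_word u) i = inv_letter (periodic_nth u j)"
proof -
  let ?L = "length u"
  have pos: "0 < ?L" using assms(1) by simp
  have "(Suc (i mod ?L + j mod ?L)) mod ?L = Suc (i + j) mod ?L"
    by (metis mod_Suc_eq mod_add_eq)
  then have "?L dvd Suc (i mod ?L + j mod ?L)" using assms(2) by (simp add: dvd_eq_mod_eq_0)
  then obtain q where q: "Suc (i mod ?L + j mod ?L) = ?L * q" by (elim dvdE)
  have bounds: "i mod ?L < ?L" "j mod ?L < ?L" using pos by simp_all
  then have "?L * q < ?L * 2" "0 < ?L * q" unfolding q[symmetric] by linarith+
  then have "q = 1" using pos by (simp add: mult_less_cancel1)
  then have "?L - Suc (i mod ?L) = j mod ?L" using q by simp
  then show ?thesis using bounds by (simp add: periodic_nth_def rev_nth)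
qed

lemma all_less_reflect: "(\<forall>j<n. P j) \<longleftrightarrow> (\<forall>j<n. P (n - Suc j))" for n :: nat
proof (intro iffI allI impI)
  fix j assume "\<forall>j<n. P (n - Suc j)" "j < n"
  moreover from this have "n - Suc j < n" "n - Suc (n - Suc j) = j" by simp_all
  ultimately show "P j" by metis
qed simp

text \<open>
  Reading backwards and inverting letters turns an occurrence of \<open>w\<close> at position \<open>i\<close> of the cyclic
  word \<open>u\<inverse>\<close> into one of \<open>w\<inverse>\<close> at position \<open>- i - length w\<close> of \<open>u\<close>. In the proof \<open>i\<close> is
  replaced by \<open>length u - Suc i\<close>, and \<open>i + a\<close> is a natural number that represents the reflected
  position modulo \<open>length u\<close>.
\<close>

lemma cyclic_count_inv_word: "cyclic_count w (inv_word u) = cyclic_count (inv_word w) u"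
proof (cases "u = []")
  case False
  let ?L = "length u" and ?n = "length w"
  define a where "a = Suc (?n * (?L - 1))"
  have match: "matches_at w (inv_word u) (?L - Suc i) = matches_at (inv_word w) u (i + a)"
    if i: "i < ?L" for i
  proof -
    have step: "periodic_nth (inv_word u) (?L - Suc i + j) = w ! j \<longleftrightarrow>
        periodic_nth u (i + a + (?n - Suc j)) = inv_word w ! (?n - Suc j)" if j: "j < ?n" for j
    proof -
      have "?L * ?n = ?n + ?n * (?L - 1)" using False by (cases ?L) simp_all
      then have "Suc ((?L - Suc i + j) + (i + a + (?n - Suc j))) = ?L * Suc ?n"
        using i j unfolding a_def mult_Suc_right by linarith
      then have "?L dvd Suc ((?L - Suc i + j) + (i + a + (?n - Suc j)))" by simp
      then have "periodic_nth (inv_word u) (?L - Suc i + j)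
          = inv_letter (periodic_nth u (i + a + (?n - Suc j)))"
        by (rule periodic_nth_inv_word[OF False])
      moreover have "inv_word w ! (?n - Suc j) = inv_letter (w ! j)"
        using j by (simp add: rev_nth Suc_diff_Suc)
      ultimately show ?thesis by (metis inv_letter_inv_letter)
    qed
    show ?thesis
      unfolding matches_at_def length_rev length_map
      using step all_less_reflect[of ?n "\<lambda>j. periodic_nth u (i + a + j) = inv_word w ! j"] by auto
  qed
  have "cyclic_count w (inv_word u) = (\<Sum>i<?L. of_bool (matches_at w (inv_word u) (?L - Suc i)))"
    unfolding cyclic_count_def length_rev length_map by (rule sum.nat_diff_reindex[symmetric])
  also have "\<dots> = (\<Sum>i<?L. of_bool (matches_at (inv_word w) u (i + a)))"
    using match by (intro sum.cong) auto
  also have "\<dots> = cyclic_count (inv_word w) u"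
    using sum_matches_at_shift[of "inv_word w" u a 1] by simp
  finally show ?thesis .
qed (simp add: cyclic_count_def)

lemma occurrences_iff:
  "i \<in> occurrences w g \<longleftrightarrow> i + length w \<le> length g \<and> (\<forall>j<length w. g ! (i + j) = w ! j)"
  by (auto simp: occurrences_def list_eq_iff_nth_eq)

lemma finite_occurrences: "finite (occurrences w g)"
  by (rule finite_subset[of _ "{..length g}"]) (auto simp: occurrences_iff)

lemma disjoint_count_unbordered:
  assumes "unbordered w"
  shows "disjoint_count w g = card (occurrences w g)"
proof -
  let ?O = "occurrences w g"
  let ?disj = "\<lambda>i j. i + length w \<le> j \<or> j + length w \<le> i"
  have later: "i + length w \<le> j" if "i \<in> ?O" "j \<in> ?O" "i < j" for i j
  proof (rule ccontr)
    assume "\<not> i + length w \<le> j"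
    then obtain k where k: "j = i + k" "0 < k" "k < length w"
      using \<open>i < j\<close> by (metis less_imp_add_positive nat_add_left_cancel_less not_le)
    have "w ! m = w ! (k + m)" if "m < length w - k" for m
    proof -
      have "w ! m = g ! (j + m)" using \<open>j \<in> ?O\<close> that by (simp add: occurrences_iff)
      also have "\<dots> = g ! (i + (k + m))" using k by (simp add: add.assoc)
      also have "\<dots> = w ! (k + m)" using \<open>i \<in> ?O\<close> that by (simp add: occurrences_iff)
      finally show ?thesis .
    qed
    then have "take (length w - k) w = drop k w" by (intro nth_equalityI) simp_all
    then show False using assms k unfolding unbordered_def by blast
  qed
  have "pairwise ?disj ?O"
    unfolding pairwise_def
  proof (intro ballI impI)
    fix i j assume "i \<in> ?O" "j \<in> ?O" "i \<noteq> j"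
    then show "?disj i j" using later[of i j] later[of j i] by linarith
  qed
  then show ?thesis
    unfolding disjoint_count_def
    using finite_occurrences[of w g]
    by (intro Max_eqI finite_subset[of "{card P |P. P \<subseteq> ?O \<and> pairwise ?disj P}" "card ` Pow ?O"])
       (auto intro: card_mono)
qed

text \<open>
  The cyclic count can only be wrong about occurrences in the fixed ends \<open>h\<close> and \<open>h'\<close> or across the
  boundary of the periodic part, and there are boundedly many positions for these.
\<close>

lemma card_occurrences_periodic:
  assumes t: "length t = m * length u" "\<And>i. i < length t \<Longrightarrow> t ! i = periodic_nth u (i + k)"
  shows "\<bar>real (card (occurrences w (h @ t @ h'))) - real m * real (cyclic_count w u)\<bar>
    \<le> real (length h + length h' + length w + 1)"
proof -
  let ?O = "occurrences w (h @ t @ h')"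
  let ?n = "length w" and ?T = "length t" and ?a = "length h" and ?b = "length h'"
  define S where "S = {i. i < ?T \<and> matches_at w u (i + k)}"
  have "card S = (\<Sum>i<?T. of_bool (matches_at w u (i + k)))"
    by (simp add: S_def sum_of_bool_eq Int_def)
  then have S: "card S = m * cyclic_count w u"
    using sum_matches_at_shift[of w u k m] t(1) by simp
  have fin: "finite S" by (simp add: S_def)
  have inner: "i + ?a \<in> ?O \<longleftrightarrow> i \<in> S" if "i + ?n \<le> ?T" "i < ?T" for i
    using that t(2) by (auto simp: occurrences_iff nth_append matches_at_def S_def add_ac)
  have "?O \<subseteq> (\<lambda>i. i + ?a) ` S \<union> {..<?a} \<union> {?a + ?T - ?n..?a + ?T + ?b - ?n}"
  proof
    fix i assume i: "i \<in> ?O"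
    then have le: "i + ?n \<le> ?a + ?T + ?b" by (simp add: occurrences_iff)
    consider "i < ?a" | "i \<ge> ?a" "i - ?a + ?n \<le> ?T" "i - ?a < ?T" | "?a + ?T \<le> i + ?n"
      by linarith
    then show "i \<in> (\<lambda>i. i + ?a) ` S \<union> {..<?a} \<union> {?a + ?T - ?n..?a + ?T + ?b - ?n}"
    proof cases
      case 2
      then have "i - ?a \<in> S" using inner[of "i - ?a"] i by simp
      then have "i \<in> (\<lambda>i. i + ?a) ` S" using 2 by (intro image_eqI[of _ _ "i - ?a"]) simp_all
      then show ?thesis by blast
    qed (use le in auto)
  qed
  then have "card ?O \<le> card ((\<lambda>i. i + ?a) ` S \<union> {..<?a} \<union> {?a + ?T - ?n..?a + ?T + ?b - ?n})"
    using fin by (intro card_mono) auto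
  also have "\<dots> \<le> card ((\<lambda>i. i + ?a) ` S) + card {..<?a} + card {?a + ?T - ?n..?a + ?T + ?b - ?n}"
    by (meson add_right_mono card_Un_le order_trans)
  also have "\<dots> \<le> card S + ?a + (?b + 1)"
    using card_image_le[OF fin, of "\<lambda>i. i + ?a"] by simp
  finally have upper: "card ?O \<le> card S + ?a + (?b + 1)" .
  have "S \<subseteq> (S - {?T - ?n..<?T}) \<union> {?T - ?n..<?T}" by blast
  then have "card S \<le> card (S - {?T - ?n..<?T}) + card {?T - ?n..<?T}"
    using fin by (meson card_Un_le card_mono finite_Diff finite_UnI finite_atLeastLessThan order_trans)
  also have "card (S - {?T - ?n..<?T}) = card ((\<lambda>i. i + ?a) ` (S - {?T - ?n..<?T}))"
    by (simp add: card_image)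
  also have "\<dots> \<le> card ?O"
    using inner by (intro card_mono finite_occurrences) (auto simp: S_def)
  finally have "card S \<le> card ?O + card {?T - ?n..<?T}" by simp
  moreover have "card {?T - ?n..<?T} \<le> ?n" by simp
  ultimately have lower: "card S \<le> card ?O + ?n" by linarith
  show ?thesis using upper lower unfolding S[symmetric] of_nat_mult[symmetric] by linarith
qed

text \<open>For unbordered \<open>w\<close> and cyclically reduced \<open>u\<close> this is \<open>\<phi>\<^sub>w(u)\<close>.\<close>

definition signed_cyclic_count :: "'a word \<Rightarrow> 'a word \<Rightarrow> real" where
  "signed_cyclic_count w u = real (cyclic_count w u) - real (cyclic_count (inv_word w) u)"

lemma signed_cyclic_count_rotate: "signed_cyclic_count w (rotate k u) = signed_cyclic_count w u"
  by (simp add: signed_cyclic_count_def cyclic_count_rotate)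

lemma signed_cyclic_count_inv_word: "signed_cyclic_count w (inv_word u) = - signed_cyclic_count w u"
  by (simp add: signed_cyclic_count_def cyclic_count_inv_word)

lemma lim_bounded_deviation:
  fixes a :: "nat \<Rightarrow> real"
  assumes "\<And>m. \<bar>a m - real m * c\<bar> \<le> K"
  shows "lim (\<lambda>m. a m / real m) = c"
proof (rule limI)
  have "(\<lambda>m. (a m - real m * c) / real m) \<longlonglongrightarrow> 0"
  proof (rule tendsto_0_le[OF lim_const_over_n[of K], where K = 1], intro always_eventually allI)
    fix m
    have "\<bar>a m - real m * c\<bar> \<le> \<bar>K\<bar>" using assms[of m] by linarith
    then show "norm ((a m - real m * c) / real m) \<le> norm (K / real m) * 1"
      by (simp add: abs_divide divide_right_mono)
  qed
  then have "(\<lambda>m. (a m - real m * c) / real m + c) \<longlonglongrightarrow> 0 + c" by (intro tendsto_intros)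
  moreover have "eventually (\<lambda>m. (a m - real m * c) / real m + c = a m / real m) sequentially"
    using eventually_gt_at_top[of 0] by eventually_elim (simp add: field_simps)
  ultimately show "(\<lambda>m. a m / real m) \<longlonglongrightarrow> c"
    by (simp add: filterlim_cong)
qed

lemma counting_qm_Nil:
  assumes "w \<in> carrier (free_group X)" "unbordered w"
  shows "counting_qm X w [] = 0"
proof -
  have "occurrences (inv_word w) [] = occurrences w []" by (auto simp: occurrences_iff)
  then show ?thesis
    by (simp only: counting_qm_def inv_free_group[OF assms(1)] disjoint_count_unbordered[OF assms(2)]
        disjoint_count_unbordered[OF unbordered_inv_word[OF assms(2)]])
qed

text \<open>
  An unbordered word never overlaps itself, so disjoint copies are just occurrences, and these are
  counted in powers up to a bounded error by the cyclic count.
\<close>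

lemma homog_counting_qm_conjugate_power:
  assumes w: "w \<in> carrier (free_group X)" "unbordered w"
    and g: "h @ rotate k (word_power u n) @ inv_word h \<in> carrier (free_group X)"
    and u: "cyclically_reduced u" "u \<noteq> []" and n: "n \<noteq> 0"
  shows "homog_counting_qm X w (h @ rotate k (word_power u n) @ inv_word h)
    = real n * signed_cyclic_count w u"
proof -
  define t where "t = rotate k (word_power u n)"
  let ?g = "h @ t @ inv_word h" and ?c = "signed_cyclic_count w u"
  have t: "cyclically_reduced t" "t \<noteq> []"
    using u n by (auto simp: t_def intro!: cyclically_reduced_rotate cyclically_reduced_word_power)
  have len: "length (word_power t m) = (m * n) * length u" for m
    by (simp add: t_def)
  have nth: "word_power t m ! i = periodic_nth u (i + k)" if "i < length (word_power t m)" for m i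
  proof -
    have "word_power t m ! i = periodic_nth t i" using that by (simp add: nth_word_power)
    also have "\<dots> = periodic_nth u (i + k)"
      using u(2) n unfolding t_def by (simp add: periodic_nth_rotate periodic_nth_word_power)
    finally show ?thesis .
  qed
  define K where "K = real (length h + length (inv_word h) + length w + 1)"
  have bound: "\<bar>counting_qm X w (?g [^]\<^bsub>free_group X\<^esub> m) - real m * (real n * ?c)\<bar> \<le> 2 * K" for m
  proof (cases m)
    case 0
    then show ?thesis using counting_qm_Nil[OF w] by (simp add: K_def free_group_def)
  next
    case (Suc m')
    let ?x = "h @ word_power t m @ inv_word h"
    have "?g [^]\<^bsub>free_group X\<^esub> m = ?x"
      unfolding Suc by (rule nat_pow_conjugate[OF g[folded t_def] t])
    then have "counting_qm X w (?g [^]\<^bsub>free_group X\<^esub> m)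
        = real (card (occurrences w ?x)) - real (card (occurrences (inv_word w) ?x))"
      by (simp only: counting_qm_def inv_free_group[OF w(1)] disjoint_count_unbordered[OF w(2)]
          disjoint_count_unbordered[OF unbordered_inv_word[OF w(2)]])
    moreover have "\<bar>real (card (occurrences w ?x)) - real (m * n) * real (cyclic_count w u)\<bar> \<le> K"
      "\<bar>real (card (occurrences (inv_word w) ?x)) - real (m * n) * real (cyclic_count (inv_word w) u)\<bar> \<le> K"
      using card_occurrences_periodic[OF len nth, of m w h "inv_word h"]
        card_occurrences_periodic[OF len nth, of m "inv_word w" h "inv_word h"]
      unfolding K_def by (simp_all only: length_rev length_map)
    moreover have "real m * (real n * ?c)
        = real (m * n) * real (cyclic_count w u) - real (m * n) * real (cyclic_count (inv_word w) u)"
      by (simp add: signed_cyclic_count_def algebra_simps)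
    ultimately show ?thesis by linarith
  qed
  then show ?thesis
    unfolding homog_counting_qm_def t_def[symmetric] by (rule lim_bounded_deviation)
qed

text \<open>
  A match of an unbordered word along a shorter period would give it a border, and a match along a
  period of the same length is a rotation.
\<close>

lemma cyclic_count_effective:
  assumes r: "antisym r" and v: "effective X r v" and u: "effective X r u"
    and len: "length u \<le> length v"
  shows "cyclic_count v u = of_bool (u = v)"
proof -
  have match: "u = v \<and> i = 0" if "i < length u" "matches_at v u i" for i
  proof -
    have "\<not> length u < length v"
    proof
      assume less: "length u < length v"
      have "v ! j = v ! (length u + j)" if "j < length v - length u" for j
      proof -
        have "v ! j = periodic_nth u (i + j)" "v ! (length u + j) = periodic_nth u (i + (length u + j))"
          using that \<open>matches_at v u i\<close> by (simp_all add: matches_at_def)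
        then show ?thesis
          using mod_add_self2[of "i + j" "length u"] by (simp add: periodic_nth_def add_ac)
      qed
      then have "take (length v - length u) v = drop (length u) v"
        by (intro nth_equalityI) simp_all
      moreover have "0 < length u" using \<open>i < length u\<close> by linarith
      ultimately show False
        using less effective_unbordered[OF r v] unfolding unbordered_def by blast
    qed
    then have eq: "length u = length v" using len by simp
    then have rot: "v = rotate i u"
      using that by (intro nth_equalityI) (auto simp: matches_at_def periodic_nth_def nth_rotate)
    then have "u = v" by (rule effective_rotation_unique[OF r u v])
    moreover have "i = 0"
      using u rot \<open>u = v\<close> that(1) unfolding effective_iff primitive_def by (metis not_gr_zero)
    ultimately show ?thesis ..
  qed
  show ?thesis
  proof (cases "u = v")
    case True
    have "u \<noteq> []" using u by (simp add: effective_iff primitive_def)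
    have "matches_at v u i \<longleftrightarrow> i = 0" if "i < length u" for i
      using match[OF that] True by (auto simp: matches_at_def periodic_nth_def)
    then have "cyclic_count v u = (\<Sum>i<length u. of_bool (i = 0))"
      unfolding cyclic_count_def by (intro sum.cong) auto
    then show ?thesis using \<open>u \<noteq> []\<close> True by (simp add: of_bool_def)
  next
    case False
    then show ?thesis using match by (auto simp: cyclic_count_def)
  qed
qed

lemma signed_cyclic_count_effective_inverse:
  assumes "linear_order_on (letters X) r" "effective X r u"
  shows "signed_cyclic_count w (effective_inverse X r u) = - signed_cyclic_count w u"
  using effective_inverse(2)[OF assms]
  by (auto simp: signed_cyclic_count_rotate signed_cyclic_count_inv_word)

lemma signed_cyclic_count_effective:
  assumes r: "linear_order_on (letters X) r" and v: "effective X r v" and u: "effective X r u"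
    and len: "length u \<le> length v"
  shows "signed_cyclic_count v u = of_bool (u = v) - of_bool (u = effective_inverse X r v)"
proof -
  let ?e = "effective_inverse X r"
  have asym: "antisym r" using r unfolding linear_order_on_def partial_order_on_def by blast
  obtain k where "?e u = rotate k (inv_word u)" using effective_inverse(2)[OF r u] by blast
  then have "cyclic_count (inv_word v) u = cyclic_count v (?e u)"
    by (simp add: cyclic_count_rotate cyclic_count_inv_word)
  also have "\<dots> = of_bool (?e u = v)"
    using cyclic_count_effective[OF asym v effective_inverse(1)[OF r u]]
      length_effective_inverse[OF r u] len by simp
  also have "?e u = v \<longleftrightarrow> u = ?e v"
    using effective_inverse_involution[OF r u] effective_inverse_involution[OF r v] by metis
  finally show ?thesis
    using cyclic_count_effective[OF asym v u len] by (simp add: signed_cyclic_count_def)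
qed

section \<open>Chains modulo powers and conjugation\<close>

abbreviation basis_chain :: "'a word \<Rightarrow> 'a word \<Rightarrow>\<^sub>0 real" where
  "basis_chain g \<equiv> Poly_Mapping.single g 1"

lemma null_chains_power:
  assumes "g \<in> carrier (free_group X)"
  shows "basis_chain (g [^]\<^bsub>free_group X\<^esub> (n::int)) - real_of_int n *\<^sub>R basis_chain g \<in> null_chains X"
  unfolding null_chains_def using assms by (intro real_vector.span_base) blast

lemma null_chains_conjugate:
  assumes "g \<in> carrier (free_group X)" "h \<in> carrier (free_group X)"
  shows "basis_chain g
      - basis_chain (h \<otimes>\<^bsub>free_group X\<^esub> g \<otimes>\<^bsub>free_group X\<^esub> inv\<^bsub>free_group X\<^esub> h) \<in> null_chains X"
  unfolding null_chains_def using assms by (intro real_vector.span_base) blast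

lemma null_chains_zero: "0 \<in> null_chains X"
  unfolding null_chains_def by (rule real_vector.span_zero)

lemma null_chains_add: "a \<in> null_chains X \<Longrightarrow> b \<in> null_chains X \<Longrightarrow> a + b \<in> null_chains X"
  unfolding null_chains_def by (rule real_vector.span_add)

lemma null_chains_diff: "a \<in> null_chains X \<Longrightarrow> b \<in> null_chains X \<Longrightarrow> a - b \<in> null_chains X"
  unfolding null_chains_def by (rule real_vector.span_diff)

lemma null_chains_scaleR: "a \<in> null_chains X \<Longrightarrow> c *\<^sub>R a \<in> null_chains X"
  unfolding null_chains_def by (rule real_vector.span_scale)

lemma null_chains_diff_trans:
  assumes "a - b \<in> null_chains X" "b - c \<in> null_chains X"
  shows "a - c \<in> null_chains X"
  using null_chains_add[OF assms] by simp

lemma chain_class_eq_if_null: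
  assumes "c \<in> null_chains X"
  shows "chain_class X c = chain_class X 0"
proof -
  have "d - c \<in> null_chains X \<longleftrightarrow> d \<in> null_chains X" for d
    using null_chains_diff[of d X c] null_chains_add[of "d - c" X c] assms by auto
  then show ?thesis by (simp add: chain_class_def)
qed

lemma null_chains_rotate:
  assumes "w \<in> carrier (free_group X)" "cyclically_reduced w"
  shows "basis_chain (rotate k w) - basis_chain w \<in> null_chains X"
proof -
  obtain h where "h \<in> carrier (free_group X)"
    "rotate k w = h \<otimes>\<^bsub>free_group X\<^esub> w \<otimes>\<^bsub>free_group X\<^esub> inv\<^bsub>free_group X\<^esub> h"
    by (rule rotate_eq_conjugate[OF assms])
  then show ?thesis
    using null_chains_scaleR[OF null_chains_conjugate[OF assms(1)], of h "-1"] by simp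
qed

lemma null_chains_effective_inverse:
  assumes r: "linear_order_on (letters X) r" and u: "effective X r u"
  shows "basis_chain u + basis_chain (effective_inverse X r u) \<in> null_chains X"
proof -
  interpret group "free_group X" by (rule group_free_group)
  have u': "u \<in> carrier (free_group X)" "cyclically_reduced u"
    using u by (simp_all add: effective_iff)
  have inv: "inv_word u \<in> carrier (free_group X)"
    using inv_closed[OF u'(1)] by (simp only: inv_free_group[OF u'(1)])
  obtain k where "effective_inverse X r u = rotate k (inv_word u)"
    using effective_inverse(2)[OF r u] by blast
  then have "basis_chain (effective_inverse X r u) - basis_chain (inv_word u) \<in> null_chains X"
    using null_chains_rotate[OF inv cyclically_reduced_inv_word[OF u'(2)]] by simp
  moreover have "u [^]\<^bsub>free_group X\<^esub> (-1::int) = inv_word u"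
    using int_pow_neg[OF u'(1), of 1] int_pow_1[OF u'(1)] inv_free_group[OF u'(1)] by simp
  then have "basis_chain (inv_word u) + basis_chain u \<in> null_chains X"
    using null_chains_power[OF u'(1), of "-1"] by simp
  ultimately show ?thesis using null_chains_add by fastforce
qed

lemma rotate_word_power: "rotate k (word_power u n) = word_power (rotate k u) n"
proof (cases "u = [] \<or> n = 0")
  case False
  show ?thesis
  proof (rule nth_equalityI)
    fix i assume i: "i < length (rotate k (word_power u n))"
    then have "rotate k (word_power u n) ! i = periodic_nth (rotate k (word_power u n)) i"
      by (simp add: periodic_nth_def)
    also have "\<dots> = periodic_nth u (i + k)"
      using False by (simp add: periodic_nth_rotate periodic_nth_word_power)
    also have "\<dots> = word_power (rotate k u) n ! i"
      using i False by (simp add: nth_word_power periodic_nth_rotate)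
    finally show "rotate k (word_power u n) ! i = word_power (rotate k u) n ! i" .
  qed simp
qed auto

text \<open>
  Every non-trivial element is conjugate to a power of an effective word; both the chain of the
  element and the values of the quasimorphisms are determined by that power.
\<close>

lemma effective_power_decomposition:
  assumes r: "linear_order_on (letters X) r" and g: "g \<in> carrier (free_group X)" "g \<noteq> []"
  obtains u n where "effective X r u"
    "basis_chain g - real n *\<^sub>R basis_chain u \<in> null_chains X"
    "\<And>w. w \<in> carrier (free_group X) \<Longrightarrow> unbordered w \<Longrightarrow>
       homog_counting_qm X w g = real n * signed_cyclic_count w u"
proof -
  interpret group "free_group X" by (rule group_free_group)
  obtain h t where g_eq: "g = h @ t @ inv_word h" and t: "t \<noteq> []" "cyclically_reduced t"
    using reduced_eq_conjugate_cyclically_reduced[of g] g by (auto simp: carrier_free_group)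
  have h: "h \<in> carrier (free_group X)" and t_car: "t \<in> carrier (free_group X)"
    using g(1) unfolding g_eq by (simp_all add: carrier_free_group reduced_append)
  obtain s n where s: "primitive s" "n \<noteq> 0" "t = word_power s n"
    using t(1) by (rule primitive_root)
  have s_cyc: "cyclically_reduced s"
    using cyclically_reduced_if_word_power[of n s] t s by simp
  have "set s \<subseteq> set t" using s(2,3) by (cases n) auto
  then have "s \<in> carrier (free_group X)"
    using t_car s_cyc by (auto simp: carrier_free_group cyclically_reduced_def)
  then obtain k where u: "effective X r (rotate k s)"
    using s_cyc s(1) by (rule effective_rotation_exists[OF r])
  define u where "u = rotate k s"
  obtain j where j: "rotate j (rotate k s) = s" by (rule rotate_inverse)
  have u_car: "u \<in> carrier (free_group X)" and u_cyc: "cyclically_reduced u" and "u \<noteq> []"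
    using u by (simp_all add: u_def effective_iff primitive_def)
  have t_eq: "t = rotate j (word_power u n)"
    using s(3) j by (simp add: u_def rotate_word_power)
  have pow: "u [^]\<^bsub>free_group X\<^esub> n = word_power u n"
    by (rule nat_pow_cyclically_reduced[OF u_car u_cyc])
  have pow_car: "word_power u n \<in> carrier (free_group X)"
    using nat_pow_closed[OF u_car, of n] pow by simp
  have conj: "g = h \<otimes>\<^bsub>free_group X\<^esub> t \<otimes>\<^bsub>free_group X\<^esub> inv\<^bsub>free_group X\<^esub> h"
    using conjugate_free_group_append[OF h, of t] g(1) unfolding g_eq carrier_free_group by blast
  have "basis_chain g - basis_chain t \<in> null_chains X"
    using null_chains_scaleR[OF null_chains_conjugate[OF t_car h], of "-1"] conj by simp
  moreover have "basis_chain t - basis_chain (word_power u n) \<in> null_chains X"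
    unfolding t_eq by (rule null_chains_rotate[OF pow_car cyclically_reduced_word_power[OF u_cyc]])
  moreover have "basis_chain (word_power u n) - real n *\<^sub>R basis_chain u \<in> null_chains X"
    using null_chains_power[OF u_car, of "int n"] pow by (simp add: int_pow_int)
  ultimately have "basis_chain g - real n *\<^sub>R basis_chain u \<in> null_chains X"
    by (blast intro: null_chains_diff_trans)
  moreover have "homog_counting_qm X w g = real n * signed_cyclic_count w u"
    if "w \<in> carrier (free_group X)" "unbordered w" for w
    using homog_counting_qm_conjugate_power[OF that _ u_cyc \<open>u \<noteq> []\<close> s(2), of h j] g(1)
    unfolding g_eq t_eq by blast
  ultimately show ?thesis using that[of u n] u unfolding u_def by blast
qed

lemma effective_power_decomposition_chain:
  assumes r: "linear_order_on (letters X) r" and gs: "set gs \<subseteq> carrier (free_group X)"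
  shows "\<exists>ps :: (nat \<times> 'a word) list. (\<forall>(n, u) \<in> set ps. effective X r u) \<and>
    (\<Sum>g\<leftarrow>gs. basis_chain g) - (\<Sum>(n, u)\<leftarrow>ps. real n *\<^sub>R basis_chain u) \<in> null_chains X \<and>
    (\<forall>w \<in> carrier (free_group X). unbordered w \<longrightarrow>
      (\<Sum>g\<leftarrow>gs. homog_counting_qm X w g) = (\<Sum>(n, u)\<leftarrow>ps. real n * signed_cyclic_count w u))"
  using gs
proof (induction gs)
  case Nil
  then show ?case by (intro exI[of _ "[]"]) (simp add: null_chains_zero)
next
  case (Cons g gs)
  then obtain ps where ps: "\<forall>(n, u) \<in> set ps. effective X r u"
    "(\<Sum>g\<leftarrow>gs. basis_chain g) - (\<Sum>(n, u)\<leftarrow>ps. real n *\<^sub>R basis_chain u) \<in> null_chains X"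
    "\<forall>w \<in> carrier (free_group X). unbordered w \<longrightarrow>
      (\<Sum>g\<leftarrow>gs. homog_counting_qm X w g) = (\<Sum>(n, u)\<leftarrow>ps. real n * signed_cyclic_count w u)"
    by auto
  show ?case
  proof (cases "g = []")
    case True
    interpret group "free_group X" by (rule group_free_group)
    have one: "g = \<one>\<^bsub>free_group X\<^esub>" using True by (simp add: free_group_def)
    have "basis_chain g \<in> null_chains X"
      using null_chains_power[of g X 0] one by simp
    then have "(\<Sum>g\<leftarrow>g # gs. basis_chain g) - (\<Sum>(n, u)\<leftarrow>ps. real n *\<^sub>R basis_chain u) \<in> null_chains X"
      using null_chains_add[OF _ ps(2)] by (simp add: add_diff_eq)
    moreover have "homog_counting_qm X w g = 0"
      if "w \<in> carrier (free_group X)" "unbordered w" for w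
    proof -
      have "counting_qm X w (g [^]\<^bsub>free_group X\<^esub> n) = 0" for n :: nat
        using counting_qm_Nil[OF that] one True nat_pow_one[of n] by simp
      then show ?thesis by (simp add: homog_counting_qm_def)
    qed
    ultimately show ?thesis using ps(1,3) by (intro exI[of _ ps]) simp
  next
    case False
    then obtain u n where u: "effective X r u"
      "basis_chain g - real n *\<^sub>R basis_chain u \<in> null_chains X"
      "\<And>w. w \<in> carrier (free_group X) \<Longrightarrow> unbordered w \<Longrightarrow>
         homog_counting_qm X w g = real n * signed_cyclic_count w u"
      using effective_power_decomposition[OF r, of g] Cons.prems by auto
    have "(\<Sum>g\<leftarrow>g # gs. basis_chain g) - (\<Sum>(n, u)\<leftarrow>(n, u) # ps. real n *\<^sub>R basis_chain u)
        \<in> null_chains X"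
      using null_chains_add[OF u(2) ps(2)] by (simp add: algebra_simps)
    then show ?thesis using ps(1,3) u(1,3) by (intro exI[of _ "(n, u) # ps"]) simp
  qed
qed

section \<open>Antisymmetrized coefficients\<close>

text \<open>
  These are the coefficients of \<open>\<Sum>\<^sub>i n\<^sub>i (u\<^sub>i - e u\<^sub>i)\<close>. With \<open>e\<close> the effective inverse this chain is,
  modulo null chains, twice \<open>\<Sum>\<^sub>i n\<^sub>i u\<^sub>i\<close>; and as a word and its inverse enter with opposite signs, any
  cancellation between them already happens in the coefficients.
\<close>

definition antisym_coeff :: "('b \<Rightarrow> 'b) \<Rightarrow> (nat \<times> 'b) list \<Rightarrow> 'b \<Rightarrow> int" where
  "antisym_coeff e ps v = (\<Sum>(n, u)\<leftarrow>ps. int n * (of_bool (u = v) - of_bool (e u = v)))"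

text \<open>
  The function \<open>F\<close> is either the inclusion of basis elements into chains or a quasimorphism; so the
  same coefficients compute the chain and the values on it.
\<close>

lemma sum_antisym_coeff:
  fixes F :: "'b \<Rightarrow> 'c::real_vector"
  assumes "finite S" "\<forall>(n, u) \<in> set ps. u \<in> S \<and> e u \<in> S"
  shows "(\<Sum>v\<in>S. real_of_int (antisym_coeff e ps v) *\<^sub>R F v) = (\<Sum>(n, u)\<leftarrow>ps. real n *\<^sub>R (F u - F (e u)))"
  using assms(2)
proof (induction ps)
  case Nil
  then show ?case by (simp add: antisym_coeff_def)
next
  case (Cons p ps)
  obtain n u where p: "p = (n, u)" by (cases p)
  have delta: "(\<Sum>v\<in>S. real n *\<^sub>R of_bool (x = v) *\<^sub>R F v) = real n *\<^sub>R F x" if "x \<in> S" for x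
  proof -
    have "(\<Sum>v\<in>S. of_bool (x = v) *\<^sub>R F v) = (\<Sum>v\<in>S. if x = v then F v else 0)"
      by (intro sum.cong) auto
    then show ?thesis using that assms(1) by (simp add: scaleR_sum_right[symmetric] del: scaleR_scaleR)
  qed
  have "real_of_int (antisym_coeff e (p # ps) v) *\<^sub>R F v = real n *\<^sub>R of_bool (u = v) *\<^sub>R F v
      - real n *\<^sub>R of_bool (e u = v) *\<^sub>R F v + real_of_int (antisym_coeff e ps v) *\<^sub>R F v" for v
    unfolding p by (simp add: antisym_coeff_def algebra_simps)
  then show ?case
    using Cons delta[of u] delta[of "e u"] unfolding p
    by (simp add: sum.distrib sum_subtractf scaleR_diff_right del: scaleR_scaleR)
qed

lemma antisym_coeff_involution:
  assumes "\<forall>(n, u) \<in> set ps. e (e u) = u" "e (e v) = v"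
  shows "antisym_coeff e ps (e v) = - antisym_coeff e ps v"
  using assms(1)
proof (induction ps)
  case (Cons p ps)
  obtain n u where p: "p = (n, u)" by (cases p)
  have "u = e v \<longleftrightarrow> e u = v" "e u = e v \<longleftrightarrow> u = v" using Cons.prems assms(2) p by auto
  then show ?case using Cons p by (simp add: antisym_coeff_def algebra_simps)
qed (simp add: antisym_coeff_def)

theorem proposition3p3:
  fixes X :: "'a set" and r :: "'a letter rel" and gs :: "'a word list"
  assumes "well_order_on (letters X) r"
    and "set gs \<subseteq> carrier (free_group X)"
    and "chain_class X (\<Sum>g\<leftarrow>gs. Poly_Mapping.single g 1) \<noteq> chain_class X 0"
  shows "\<exists>w\<in>carrier (free_group X). effective X r w \<and>
           (\<Sum>g\<leftarrow>gs. homog_counting_qm X w g) \<ge> 1"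
proof -
  let ?e = "effective_inverse X r"
  have r: "linear_order_on (letters X) r"
    using assms(1) by (simp add: well_order_on_def)
  have asym: "antisym r" using r unfolding linear_order_on_def partial_order_on_def by blast
  obtain ps :: "(nat \<times> 'a word) list" where
    eff: "\<forall>(n, u) \<in> set ps. effective X r u" and
    chain: "(\<Sum>g\<leftarrow>gs. basis_chain g) - (\<Sum>(n, u)\<leftarrow>ps. real n *\<^sub>R basis_chain u) \<in> null_chains X" and
    homog: "\<And>w. w \<in> carrier (free_group X) \<Longrightarrow> unbordered w \<Longrightarrow>
      (\<Sum>g\<leftarrow>gs. homog_counting_qm X w g) = (\<Sum>(n, u)\<leftarrow>ps. real n * signed_cyclic_count w u)"
    using effective_power_decomposition_chain[OF r assms(2)] by blast
  define c where "c = antisym_coeff ?e ps"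
  define S where "S = snd ` set ps \<union> ?e ` snd ` set ps"
  have fin: "finite S" by (simp add: S_def)
  have S: "\<forall>(n, u) \<in> set ps. u \<in> S \<and> ?e u \<in> S" by (force simp: S_def)
  have S_eff: "effective X r v" if "v \<in> S" for v
    using that eff effective_inverse(1)[OF r] by (auto simp: S_def)
  have S_inv: "?e v \<in> S" if "v \<in> S" for v
    using that eff effective_inverse_involution[OF r] by (force simp: S_def)
  have c_inv: "c (?e v) = - c v" if "v \<in> S" for v
    unfolding c_def using eff effective_inverse_involution[OF r] S_eff[OF that]
    by (intro antisym_coeff_involution) auto
  have "\<exists>v\<in>S. c v \<noteq> 0"
  proof (rule ccontr)
    assume "\<not> (\<exists>v\<in>S. c v \<noteq> 0)"
    then have zero: "(\<Sum>(n, u)\<leftarrow>ps. real n *\<^sub>R (basis_chain u - basis_chain (?e u))) = 0"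
      using sum_antisym_coeff[OF fin S, of basis_chain] by (simp add: c_def)
    have "(\<Sum>(n, u)\<leftarrow>ps. real n *\<^sub>R (basis_chain u + basis_chain (?e u))) \<in> null_chains X"
      using eff
    proof (induction ps)
      case (Cons p ps)
      then show ?case
        by (cases p) (auto intro!: null_chains_add null_chains_scaleR
            null_chains_effective_inverse[OF r] simp del: scaleR_add_right)
    qed (simp add: null_chains_zero)
    moreover have "(\<Sum>(n, u)\<leftarrow>ps. real n *\<^sub>R (basis_chain u + basis_chain (?e u)))
        + (\<Sum>(n, u)\<leftarrow>ps. real n *\<^sub>R (basis_chain u - basis_chain (?e u)))
        = 2 *\<^sub>R (\<Sum>(n, u)\<leftarrow>ps. real n *\<^sub>R basis_chain u)"
      by (induction ps) (auto simp: algebra_simps scaleR_2)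
    ultimately have "2 *\<^sub>R (\<Sum>(n, u)\<leftarrow>ps. real n *\<^sub>R basis_chain u) \<in> null_chains X"
      using zero by simp
    from null_chains_scaleR[OF this, of "1/2"]
    have "(\<Sum>(n, u)\<leftarrow>ps. real n *\<^sub>R basis_chain u) \<in> null_chains X" by simp
    from null_chains_add[OF chain this]
    have "(\<Sum>g\<leftarrow>gs. basis_chain g) \<in> null_chains X" by simp
    then show False using assms(3) chain_class_eq_if_null by blast
  qed
  then have nonempty: "{v \<in> S. c v \<noteq> 0} \<noteq> {}" by blast
  have fin': "finite (length ` {v \<in> S. c v \<noteq> 0})" using fin by simp
  \<comment> \<open>Length must be maximal so that only coefficients of words not longer than \<open>w\<close> remain below.\<close>
  obtain u where u: "u \<in> S" "c u \<noteq> 0" and longest: "\<And>v. v \<in> S \<Longrightarrow> c v \<noteq> 0 \<Longrightarrow> length v \<le> length u"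
  proof -
    have "Max (length ` {v \<in> S. c v \<noteq> 0}) \<in> length ` {v \<in> S. c v \<noteq> 0}"
      using fin' nonempty by (intro Max_in) auto
    then show ?thesis using that Max_ge[OF fin'] by fastforce
  qed
  obtain w where w: "w \<in> S" "c w > 0" and len: "length w = length u"
  proof (cases "c u > 0")
    case False
    then have "c (?e u) > 0" using u c_inv by simp
    then show ?thesis
      using that[of "?e u"] u S_inv length_effective_inverse[OF r S_eff] by simp
  qed (use u that in blast)
  note w_eff = S_eff[OF w(1)]
  let ?\<phi> = "signed_cyclic_count w"
  have "2 * (\<Sum>(n, u)\<leftarrow>ps. real n * ?\<phi> u) = (\<Sum>(n, u)\<leftarrow>ps. real n *\<^sub>R (?\<phi> u - ?\<phi> (?e u)))"
    using eff by (induction ps) (auto simp: signed_cyclic_count_effective_inverse[OF r] algebra_simps)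
  also have "\<dots> = (\<Sum>v\<in>S. real_of_int (c v) * ?\<phi> v)"
    using sum_antisym_coeff[OF fin S, of ?\<phi>] by (simp add: c_def)
  also have "\<dots> = (\<Sum>v\<in>S. real_of_int (c v) * (of_bool (v = w) - of_bool (v = ?e w)))"
  proof (intro sum.cong refl)
    fix v assume v: "v \<in> S"
    show "real_of_int (c v) * ?\<phi> v = real_of_int (c v) * (of_bool (v = w) - of_bool (v = ?e w))"
    proof (cases "c v = 0")
      case False
      then show ?thesis
        using signed_cyclic_count_effective[OF r w_eff S_eff[OF v]] longest[OF v] len by simp
    qed simp
  qed
  also have "\<dots> = real_of_int (c w) - real_of_int (c (?e w))"
    using fin w(1) S_inv[OF w(1)]
    by (simp add: right_diff_distrib sum_subtractf of_bool_def if_distrib[of "\<lambda>x. _ * x"] cong: if_cong)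
  also have "\<dots> = 2 * real_of_int (c w)" using c_inv[OF w(1)] by simp
  finally have "(\<Sum>(n, u)\<leftarrow>ps. real n * ?\<phi> u) \<ge> 1" using w(2) by simp
  moreover have "w \<in> carrier (free_group X)" using w_eff by (simp add: effective_iff)
  ultimately show ?thesis
    using homog effective_unbordered[OF asym w_eff] w_eff by auto
qed

end
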